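(* For every $n\ge1$, the total number of column-restricted parking functions of size $n$ is $(2n-1)!!=(2n-1)(2n-3)\cdots(3)(1)$.
   Context: A Dyck path of height $n$ is a path from $(0,0)$ to $(n,n)$ with unit up and right steps staying weakly above $y=x$. A parking function of size $n$ is a Dyck path of height $n$ together with a labeling of the unit squares having an up-step on their left side by $1,2,\ldots,n$, each used once, increasing from bottom to top in each column. Equivalently, it is a sequence of $n$ disjoint (possibly empty) sets (columns) with union $\{1,\ldots,n\}$ whose sizes $(k_1,\ldots,k_n)$ satisfy $k_1+\cdots+k_j\ge j$ for all $j<n$. For a label $a$ of a parking function $P$, the dominance index $d_P(a)$ is the number of columns strictly to the left of the column of $a$ that contain no label greater than $a$ (empty columns count). $P$ is column-restricted if $d_P(a)<a$ for every label $a$. *)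

theory Defs
  imports "HOL-Library.FuncSet"
begin

datatype step = Up | Right

definition dyck_path :: "nat \<Rightarrow> step list \<Rightarrow> bool" where
  "dyck_path n p \<longleftrightarrow>
     count_list p Up = n \<and> count_list p Right = n \<and>
     (\<forall>k\<le>length p. count_list (take k p) Right \<le> count_list (take k p) Up)"

text \<open>A unit square is represented by its lower left corner \<open>(x, y)\<close>, so the column of a
  square is its first component. The point reached after \<open>k\<close> steps is the lower left corner of the
  square to the right of step \<open>k\<close> (counting from 0) if that step goes up.\<close>

definition up_squares :: "step list \<Rightarrow> (nat \<times> nat) set" where
  "up_squares p =
     {(count_list (take k p) Right, count_list (take k p) Up) | k. k < length p \<and> p ! k = Up}"

text \<open>The labeling is an extensional function on the squares, so that labelings that agree on all
  squares are counted only once.\<close>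

type_synonym labeled_path = "step list \<times> (nat \<times> nat \<Rightarrow> nat)"

definition parking_function :: "nat \<Rightarrow> labeled_path \<Rightarrow> bool" where
  "parking_function n P \<longleftrightarrow> (case P of (p, l) \<Rightarrow>
     dyck_path n p \<and>
     l \<in> extensional (up_squares p) \<and>
     bij_betw l (up_squares p) {1..n} \<and>
     (\<forall>x y y'. (x, y) \<in> up_squares p \<and> (x, y') \<in> up_squares p \<and> y < y' \<longrightarrow> l (x, y) < l (x, y')))"

definition labels :: "labeled_path \<Rightarrow> nat set" where
  "labels P = (case P of (p, l) \<Rightarrow> l ` up_squares p)"

definition column :: "labeled_path \<Rightarrow> nat \<Rightarrow> nat set" where
  "column P x = (case P of (p, l) \<Rightarrow> {l (x, y) | y. (x, y) \<in> up_squares p})"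

definition column_of :: "labeled_path \<Rightarrow> nat \<Rightarrow> nat" where
  "column_of P a = (THE x. a \<in> column P x)"

definition dominance_index :: "labeled_path \<Rightarrow> nat \<Rightarrow> nat" where
  "dominance_index P a = card {x. x < column_of P a \<and> \<not> (\<exists>b\<in>column P x. b > a)}"

definition column_restricted :: "labeled_path \<Rightarrow> bool" where
  "column_restricted P \<longleftrightarrow> (\<forall>a\<in>labels P. dominance_index P a < a)"

end

theory Submission
  imports Defs
begin

text \<open>
  A parking function is determined by the function \<open>c\<close> that sends each label to its column.
  Place the labels in the order \<open>n, n - 1, \<dots>, 1\<close>. The columns that count for the dominance index
  of \<open>a\<close> are those to the left of \<open>c a\<close> that are still empty when \<open>a\<close> is placed. So \<open>a\<close> may go into
  any column up to and including the \<open>a\<close>-th empty one, and this rule alone already forces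
  \<open>c\<close> to be a parking function (\<open>placements_parking\<close>): if \<open>a\<close> is the smallest label in column \<open>j\<close> or
  further right, then at most \<open>a - 1\<close> of the first \<open>j\<close> columns are empty just before \<open>a\<close> is placed, and
  the \<open>a - 1\<close> smaller labels are placed among these \<open>j\<close> columns afterwards.

  It remains to count the runs of this process. The number \<open>ways a S\<close> of runs for the labels
  \<open>a, \<dots>, 1\<close>, when the columns in \<open>S\<close> are occupied, has no simple form for a single \<open>S\<close>, but its sum
  over all \<open>S\<close> with \<open>k\<close> elements among the first \<open>a + k\<close> columns has one. Write \<open>T a k\<close> for this sum.
  Then
  \<open>T (a + 1) k = T (a + 1) (k - 1) + (k + 1) * T a (k + 1)\<close>,
  where the first summand (absent for \<open>k = 0\<close>) collects the \<open>S\<close> that contain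
  the last column of the window, which no label can reach any more, and the second one collects the \<open>S\<close> that do not (\<open>sum_ways_last_empty\<close>). The
  solution is \<open>T a k = (2 * a - 1)!! * ((k + 2 * a) choose (2 * a))\<close>, and the desired number is
  \<open>T n 0\<close>.

  The rest translates between column functions and labeled paths. Both the path and the labeling are
  recovered from the columns: the path has one run of up-steps per column, as long as
  that column is large, and the labels increase inside a column.
\<close>

section \<open>Counting placements\<close>

text \<open>Only finite \<open>S\<close> are of interest. For these the sum is finite (\<open>finite_allowed\<close>), and it
  runs over the columns where the label \<open>Suc a\<close> may be placed.\<close>

fun ways :: "nat \<Rightarrow> nat set \<Rightarrow> nat" where
  "ways 0 S = 1"
| "ways (Suc a) S = (\<Sum>x | card ({..<x} - S) \<le> a. ways a (insert x S))"

lemma gaps_mono: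
  fixes x y :: nat
  assumes "x \<le> y"
  shows "card ({..<x} - S) \<le> card ({..<y} - S)"
  using assms by (intro card_mono) auto

text \<open>Once the first \<open>L\<close> columns have at least \<open>a\<close> gaps, the remaining labels \<open>a, \<dots>, 1\<close> all land
  there: each label fills at most one gap, while the number of gaps that may be passed drops by one.\<close>

lemma ways_cong:
  assumes "a \<le> card ({..<L} - S)" "S \<inter> {..<L} = S' \<inter> {..<L}"
  shows "ways a S = ways a S'"
  using assms
proof (induction a arbitrary: S S')
  case 0
  then show ?case by simp
next
  case (Suc a)
  have same: "{..<x} - S = {..<x} - S'" if "x \<le> L" for x
  proof -
    have "{..<x} - T = {..<x} - (T \<inter> {..<L})" for T using that by auto
    then show ?thesis using Suc.prems(2) by metis
  qed
  have below: "x < L" if "card ({..<x} - S) \<le> a" for x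
    using that Suc.prems(1) gaps_mono[of L x S] by (cases "x < L") auto
  have below': "x < L" if "card ({..<x} - S') \<le> a" for x
    using that Suc.prems(1) gaps_mono[of L x S'] same[of L] by (cases "x < L") auto
  have allowed: "{x. card ({..<x} - S) \<le> a} = {x. card ({..<x} - S') \<le> a}"
    using below below' same by (metis (no_types, lifting) less_imp_le)
  have "ways a (insert x S) = ways a (insert x S')" if "card ({..<x} - S) \<le> a" for x
  proof (rule Suc.IH)
    have "{..<L} - insert x S = ({..<L} - S) - {x}" by auto
    then have "card ({..<L} - S) - 1 \<le> card ({..<L} - insert x S)"
      by (simp add: card_Diff_singleton_if)
    then show "a \<le> card ({..<L} - insert x S)" using Suc.prems(1) by linarith
    show "insert x S \<inter> {..<L} = insert x S' \<inter> {..<L}"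
      using Suc.prems(2) by (metis Int_insert_left)
  qed
  then show ?case by (simp add: allowed[symmetric])
qed

definition subsets_of_card :: "nat \<Rightarrow> nat \<Rightarrow> nat set set" where
  "subsets_of_card m k = {U. U \<subseteq> {..<m} \<and> card U = k}"

lemma finite_subsets_of_card [simp]: "finite (subsets_of_card m k)"
  by (rule finite_subset[of _ "Pow {..<m}"]) (auto simp: subsets_of_card_def)

lemma subsets_of_card_0 [simp]: "subsets_of_card m 0 = {{}}"
  by (auto simp: subsets_of_card_def dest: finite_subset)

lemma gaps_subset_of_card:
  assumes "U \<in> subsets_of_card (a + k) k"
  shows "card ({..<a + k} - U) = a"
  using assms by (auto simp: subsets_of_card_def card_Diff_subset finite_subset)

lemma sum_subsets_of_card_Suc:
  "(\<Sum>U\<in>subsets_of_card (Suc m) (Suc k). f U) =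
     (\<Sum>U\<in>subsets_of_card m (Suc k). f U) + (\<Sum>U\<in>subsets_of_card m k. f (insert m U))"
proof -
  have fin: "finite U" if "U \<subseteq> {..<m}" for U using that finite_subset by blast
  have split: "subsets_of_card (Suc m) (Suc k) =
      subsets_of_card m (Suc k) \<union> insert m ` subsets_of_card m k" (is "?A = ?B \<union> ?C")
  proof (intro equalityI subsetI)
    fix U assume U: "U \<in> ?A"
    show "U \<in> ?B \<union> ?C"
    proof (cases "m \<in> U")
      case True
      have "finite U" using U by (auto simp: subsets_of_card_def intro: finite_subset)
      then have "U - {m} \<in> subsets_of_card m k"
        using U True by (auto simp: subsets_of_card_def less_Suc_eq)
      moreover have "U = insert m (U - {m})" using True by auto
      ultimately show ?thesis by blast
    next
      case False
      then show ?thesis using U by (auto simp: subsets_of_card_def less_Suc_eq)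
    qed
  next
    fix U assume "U \<in> ?B \<union> ?C"
    then show "U \<in> ?A"
    proof
      assume "U \<in> ?C"
      then obtain V where V: "U = insert m V" "V \<subseteq> {..<m}" "card V = k"
        by (auto simp: subsets_of_card_def)
      then have "card U = Suc k" using fin by (subst V(1), subst card_insert_disjoint) auto
      then show ?thesis using V by (auto simp: subsets_of_card_def)
    qed (auto simp: subsets_of_card_def)
  qed
  have "inj_on (insert m) (subsets_of_card m k)"
  proof (rule inj_onI)
    fix U V assume "U \<in> subsets_of_card m k" "V \<in> subsets_of_card m k" "insert m U = insert m V"
    moreover then have "m \<notin> U" "m \<notin> V" by (auto simp: subsets_of_card_def)
    ultimately show "U = V" by (metis insert_ident)
  qed
  moreover have "?B \<inter> ?C = {}" by (auto simp: subsets_of_card_def)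
  ultimately show ?thesis
    unfolding split by (subst sum.union_disjoint) (simp_all add: sum.reindex)
qed

text \<open>Double counting: a set with \<open>Suc k\<close> elements arises in \<open>Suc k\<close> ways by adding an element to a
  set with \<open>k\<close> elements.\<close>

lemma sum_insert_outside:
  "(\<Sum>U\<in>subsets_of_card m k. \<Sum>x\<in>{..<m} - U. f (insert x U)) =
     Suc k * (\<Sum>V\<in>subsets_of_card m (Suc k). f V)"
proof -
  have fin: "finite U" if "U \<subseteq> {..<m}" for U using that finite_subset by blast
  have "(\<Sum>U\<in>subsets_of_card m k. \<Sum>x\<in>{..<m} - U. f (insert x U)) =
      (\<Sum>(U, x)\<in>Sigma (subsets_of_card m k) (\<lambda>U. {..<m} - U). f (insert x U))"
    by (simp add: sum.Sigma)
  also have "\<dots> = (\<Sum>(V, x)\<in>Sigma (subsets_of_card m (Suc k)) (\<lambda>V. V). f V)"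
    by (rule sum.reindex_bij_witness[where i = "\<lambda>(V, x). (V - {x}, x)"
          and j = "\<lambda>(U, x). (insert x U, x)"])
      (auto simp: subsets_of_card_def fin card_insert_if)
  also have "\<dots> = (\<Sum>V\<in>subsets_of_card m (Suc k). \<Sum>x\<in>V. f V)"
    by (subst sum.Sigma) (auto simp: subsets_of_card_def fin)
  also have "\<dots> = (\<Sum>V\<in>subsets_of_card m (Suc k). Suc k * f V)"
    by (rule sum.cong) (auto simp: subsets_of_card_def)
  finally show ?thesis by (simp add: sum_distrib_left)
qed

text \<open>The window \<open>{..<a + k}\<close> is chosen so that exactly \<open>a\<close> columns in it are empty, as many as the
  labels that are left can reach.\<close>

definition total_ways :: "nat \<Rightarrow> nat \<Rightarrow> nat" where
  "total_ways a k = (\<Sum>U\<in>subsets_of_card (a + k) k. ways a U)"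

lemma total_ways_0: "total_ways 0 k = 1"
proof -
  have "U = {..<k}" if "U \<subseteq> {..<k}" "card U = k" for U
    using that card_subset_eq[of "{..<k}" U] by simp
  then have "subsets_of_card k k = {{..<k}}" by (auto simp: subsets_of_card_def)
  then show ?thesis by (simp add: total_ways_def)
qed

lemma ways_insert_last:
  assumes "U \<in> subsets_of_card (a + k) k"
  shows "ways a (insert (a + k) U) = ways a U"
  by (rule ways_cong[where L = "a + k", symmetric])
    (simp_all only: gaps_subset_of_card[OF assms] order_refl, auto)

text \<open>If column \<open>a + k\<close> is the \<open>Suc a\<close>-th empty one, the label \<open>Suc a\<close> can go to exactly the columns
  \<open>{..a + k}\<close>. Let \<open>V\<close> be the set occupied afterwards, with column \<open>a + k\<close> added by hand when an
  occupied column was chosen; this column is then out of reach, so adding it changes nothing. Every \<open>V\<close>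
  with \<open>Suc k\<close> elements in the window \<open>{..<a + Suc k}\<close> occurs \<open>Suc k\<close> times: if it does not contain
  \<open>a + k\<close>, once for each element that may have been new, and otherwise once for each of the \<open>k\<close> occupied
  columns and once for the choice of \<open>a + k\<close> itself.\<close>

lemma sum_ways_last_empty:
  "(\<Sum>U\<in>subsets_of_card (a + k) k. ways (Suc a) U) = Suc k * total_ways a (Suc k)"
proof -
  let ?m = "a + k"
  have expand: "ways (Suc a) U =
      Suc k * ways a (insert ?m U) + (\<Sum>x\<in>{..<?m} - U. ways a (insert x U))"
    if U: "U \<in> subsets_of_card ?m k" for U
  proof -
    have sub: "U \<subseteq> {..<?m}" "card U = k" "finite U"
      using U by (auto simp: subsets_of_card_def intro: finite_subset)
    have "{..<Suc ?m} - U = insert ?m ({..<?m} - U)" using sub by auto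
    then have "card ({..<Suc ?m} - U) = Suc a" using gaps_subset_of_card[OF U] by simp
    then have "card ({..<x} - U) \<le> a \<longleftrightarrow> x \<le> ?m" for x
      using gaps_subset_of_card[OF U] gaps_mono[of x ?m U] gaps_mono[of "Suc ?m" x U]
      by (cases "x \<le> ?m") simp_all
    then have "{x. card ({..<x} - U) \<le> a} = {..?m}" by blast
    moreover have "{..?m} = insert ?m U \<union> ({..<?m} - U)" using sub by auto
    ultimately have "ways (Suc a) U =
        (\<Sum>x\<in>insert ?m U \<union> ({..<?m} - U). ways a (insert x U))" by simp
    also have "\<dots> = (\<Sum>x\<in>insert ?m U. ways a (insert x U)) +
        (\<Sum>x\<in>{..<?m} - U. ways a (insert x U))"
      using sub by (intro sum.union_disjoint) auto
    also have "(\<Sum>x\<in>insert ?m U. ways a (insert x U)) =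
        (\<Sum>x\<in>insert ?m U. ways a (insert ?m U))"
      using ways_insert_last[OF U] by (intro sum.cong) (auto simp: insert_absorb)
    also have "card (insert ?m U) = Suc k" using sub by (subst card_insert_disjoint) auto
    then have "(\<Sum>x\<in>insert ?m U. ways a (insert ?m U)) = Suc k * ways a (insert ?m U)"
      by simp
    finally show ?thesis .
  qed
  have "(\<Sum>U\<in>subsets_of_card ?m k. ways (Suc a) U) =
      (\<Sum>U\<in>subsets_of_card ?m k.
        Suc k * ways a (insert ?m U) + (\<Sum>x\<in>{..<?m} - U. ways a (insert x U)))"
    by (rule sum.cong[OF refl], rule expand)
  also have "\<dots> =
      Suc k * (\<Sum>U\<in>subsets_of_card ?m k. ways a (insert ?m U)) +
      Suc k * (\<Sum>V\<in>subsets_of_card ?m (Suc k). ways a V)"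
    by (simp only: sum.distrib sum_insert_outside sum_distrib_left[symmetric])
  also have "\<dots> = Suc k * total_ways a (Suc k)"
    unfolding total_ways_def add_Suc_right sum_subsets_of_card_Suc by (simp only: distrib_left)
  finally show ?thesis .
qed

lemma total_ways_Suc_0: "total_ways (Suc a) 0 = total_ways a 1"
  using sum_ways_last_empty[of a 0] by (simp add: total_ways_def)

lemma total_ways_Suc_Suc:
  "total_ways (Suc a) (Suc k) = total_ways (Suc a) k + Suc (Suc k) * total_ways a (Suc (Suc k))"
proof -
  have "total_ways (Suc a) (Suc k) =
      (\<Sum>U\<in>subsets_of_card (a + Suc k) (Suc k). ways (Suc a) U) +
      (\<Sum>U\<in>subsets_of_card (Suc a + k) k. ways (Suc a) (insert (Suc a + k) U))"
    unfolding total_ways_def using sum_subsets_of_card_Suc[of "ways (Suc a)" "Suc a + k" k] by simp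
  also have "(\<Sum>U\<in>subsets_of_card (Suc a + k) k. ways (Suc a) (insert (Suc a + k) U)) =
      total_ways (Suc a) k"
    unfolding total_ways_def by (intro sum.cong refl ways_insert_last)
  finally show ?thesis by (simp only: sum_ways_last_empty add.commute)
qed

text \<open>Induction on \<open>a\<close> and, inside, on \<open>k\<close>. The factor \<open>2 * a + 1\<close> appears because
  \<open>(k + 1) * (N choose 2 * a) = (2 * a + 1) * (N choose 2 * a + 1)\<close> for \<open>N = k + 2 * a + 1\<close>;
  the inner recursion is then Pascal's rule.\<close>

lemma total_ways_eq:
  "total_ways a k = (\<Prod>i=1..a. 2 * i - 1) * ((k + 2 * a) choose (2 * a))"
proof (induction a arbitrary: k)
  case 0
  then show ?case by (simp add: total_ways_0)
next
  case (Suc a)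
  let ?D = "\<Prod>i=1..a. 2 * i - (1::nat)"
  have absorb: "Suc k * total_ways a (Suc k) =
      ?D * (2 * a + 1) * ((k + 2 * a + 1) choose (2 * a + 1))" for k
  proof -
    have "Suc k * ((k + 2 * a + 1) choose (2 * a)) =
        (2 * a + 1) * ((k + 2 * a + 1) choose (2 * a + 1))"
      using binomial_absorb_comp[of "k + 2 * a + 1" "2 * a"]
        binomial_absorption[of "2 * a" "k + 2 * a + 1"]
      by simp
    then have "?D * (Suc k * ((k + 2 * a + 1) choose (2 * a))) =
        ?D * ((2 * a + 1) * ((k + 2 * a + 1) choose (2 * a + 1)))" by (simp only:)
    moreover have "Suc k + 2 * a = k + 2 * a + 1" by simp
    then have "Suc k * total_ways a (Suc k) = ?D * (Suc k * ((k + 2 * a + 1) choose (2 * a)))"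
      by (simp only: Suc.IH mult.left_commute)
    ultimately show ?thesis by (simp only: mult.assoc)
  qed
  show ?case
  proof (induction k)
    case 0
    then show ?case using absorb[of 0] by (simp add: total_ways_Suc_0)
  next
    case (Suc k)
    have "total_ways (Suc a) (Suc k) =
        ?D * (2 * a + 1) * ((k + 2 * a + 2) choose (2 * a + 2)) +
        ?D * (2 * a + 1) * ((k + 2 * a + 2) choose (2 * a + 1))"
      using Suc.IH absorb[of "Suc k"] by (simp add: total_ways_Suc_Suc del: binomial_Suc_Suc)
    also have "\<dots> = ?D * (2 * a + 1) * ((k + 2 * a + 3) choose (2 * a + 2))"
    proof -
      have "(k + 2 * a + 3) choose (2 * a + 2) =
          ((k + 2 * a + 2) choose (2 * a + 1)) + ((k + 2 * a + 2) choose (2 * a + 2))"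
        using binomial_Suc_Suc[of "k + 2 * a + 2" "2 * a + 1"]
        by (simp add: numeral_3_eq_3 del: binomial_Suc_Suc)
      then show ?thesis by (simp only: distrib_left add.commute)
    qed
    finally show ?case by (simp add: numeral_3_eq_3 del: binomial_Suc_Suc)
  qed
qed

corollary ways_empty: "ways a {} = (\<Prod>i=1..a. 2 * i - 1)"
  using total_ways_eq[of a 0] by (simp add: total_ways_def)

section \<open>Column functions\<close>

text \<open>The set \<open>S\<close> of columns that are occupied from the start makes the induction on \<open>n\<close>
  possible: after the largest label is placed, its column joins \<open>S\<close>.\<close>

definition placements :: "nat \<Rightarrow> nat set \<Rightarrow> (nat \<Rightarrow> nat) set" where
  "placements n S = {c \<in> extensional {1..n}.
     \<forall>a\<in>{1..n}. card ({..<c a} - (S \<union> c ` {a<..n})) < a}"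

lemma finite_allowed:
  assumes "finite S"
  shows "finite {x::nat. card ({..<x} - S) \<le> a}"
proof (rule finite_subset)
  show "{x. card ({..<x} - S) \<le> a} \<subseteq> {..a + card S}"
  proof
    fix x assume "x \<in> {x. card ({..<x} - S) \<le> a}"
    moreover have "card {..<x} - card S \<le> card ({..<x} - S)"
      using assms by (rule diff_card_le_card_Diff)
    ultimately show "x \<in> {..a + card S}" by simp
  qed
qed simp

lemma bij_betw_placements_Suc:
  "bij_betw (\<lambda>(x, c). c(Suc n := x))
     (SIGMA x:{x. card ({..<x} - S) \<le> n}. placements n (insert x S)) (placements (Suc n) S)"
proof (rule bij_betw_byWitness[where f' = "\<lambda>c. (c (Suc n), restrict c {1..n})"])
  let ?A = "SIGMA x:{x. card ({..<x} - S) \<le> n}. placements n (insert x S)"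
  have img: "f ` {a<..Suc n} = insert (f (Suc n)) (f ` {a<..n})" if "a \<le> n" for a and f :: "nat \<Rightarrow> nat"
  proof -
    have "{a<..Suc n} = insert (Suc n) {a<..n}" using that by auto
    then show ?thesis by simp
  qed
  show "\<forall>xc\<in>?A. (\<lambda>c. (c (Suc n), restrict c {1..n})) ((\<lambda>(x, c). c(Suc n := x)) xc) = xc"
    by (auto simp: placements_def restrict_def extensional_def fun_eq_iff)
  show "\<forall>c\<in>placements (Suc n) S. (\<lambda>(x, c). c(Suc n := x)) (c (Suc n), restrict c {1..n}) = c"
    by (auto simp: placements_def restrict_def extensional_def fun_eq_iff)
  show "(\<lambda>(x, c). c(Suc n := x)) ` ?A \<subseteq> placements (Suc n) S"
  proof clarify
    fix x c assume x: "card ({..<x} - S) \<le> n" and c: "c \<in> placements n (insert x S)"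
    let ?c = "c(Suc n := x)"
    have "card ({..<?c a} - (S \<union> ?c ` {a<..Suc n})) < a" if a: "a \<in> {1..Suc n}" for a
    proof (cases "a = Suc n")
      case True
      then show ?thesis using x by simp
    next
      case False
      then have "?c ` {a<..Suc n} = insert x (c ` {a<..n})" using a by (subst img) auto
      then show ?thesis using c a False by (auto simp: placements_def)
    qed
    moreover have "?c \<in> extensional {1..Suc n}" using c by (auto simp: placements_def extensional_def)
    ultimately show "?c \<in> placements (Suc n) S" by (simp add: placements_def)
  qed
  show "(\<lambda>c. (c (Suc n), restrict c {1..n})) ` placements (Suc n) S \<subseteq> ?A"
  proof clarify
    fix c assume c: "c \<in> placements (Suc n) S"
    have "\<forall>a\<in>{1..Suc n}. card ({..<c a} - (S \<union> c ` {a<..Suc n})) < a"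
      using c unfolding placements_def by blast
    from bspec[OF this, of "Suc n"] have 1: "card ({..<c (Suc n)} - S) \<le> n" by simp
    have "card ({..<c a} - (insert (c (Suc n)) S \<union> restrict c {1..n} ` {a<..n})) < a"
      if a: "a \<in> {1..n}" for a
    proof -
      have "restrict c {1..n} ` {a<..n} = c ` {a<..n}" using a by (intro image_cong) auto
      then have "insert (c (Suc n)) S \<union> restrict c {1..n} ` {a<..n} = S \<union> c ` {a<..Suc n}"
        using a by (subst img) auto
      then show ?thesis using c a by (auto simp: placements_def)
    qed
    then show "c (Suc n) \<in> {x. card ({..<x} - S) \<le> n} \<and>
        restrict c {1..n} \<in> placements n (insert (c (Suc n)) S)"
      using 1 by (auto simp: placements_def)
  qed
qed

lemma finite_and_card_placements:
  assumes "finite S"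
  shows "finite (placements n S) \<and> card (placements n S) = ways n S"
  using assms
proof (induction n arbitrary: S)
  case 0
  have "placements 0 S = {\<lambda>_. undefined}" by (auto simp: placements_def)
  then show ?case by simp
next
  case (Suc n)
  note fin = finite_allowed[OF Suc.prems, where a = n]
  have "finite (SIGMA x:{x. card ({..<x} - S) \<le> n}. placements n (insert x S))"
    using fin Suc by auto
  moreover have "card (SIGMA x:{x. card ({..<x} - S) \<le> n}. placements n (insert x S)) = ways (Suc n) S"
    using fin Suc by simp
  ultimately show ?case
    using bij_betw_placements_Suc[of n S] bij_betw_finite bij_betw_same_card by metis
qed

text \<open>Let \<open>a\<close> be the smallest label outside the first \<open>j\<close> columns. At most \<open>a - 1\<close> of these columns
  have no label above \<open>a\<close>, so at least \<open>j - (a - 1)\<close> labels above \<open>a\<close> lie in them. By the choice of \<open>a\<close>,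
  so do the \<open>a - 1\<close> labels below \<open>a\<close>.\<close>

lemma placements_parking:
  assumes c: "c \<in> placements n {}" and j: "j \<le> n"
  shows "j \<le> card {a \<in> {1..n}. c a < j}"
proof (cases "\<exists>a\<in>{1..n}. j \<le> c a")
  case False
  then have "{a \<in> {1..n}. c a < j} = {1..n}" by (auto simp: not_le)
  then show ?thesis using j by simp
next
  case True
  define a where "a = Min {a \<in> {1..n}. j \<le> c a}"
  have a: "a \<in> {1..n}" "j \<le> c a"
  proof -
    have "a \<in> {a \<in> {1..n}. j \<le> c a}" unfolding a_def using True by (intro Min_in) auto
    then show "a \<in> {1..n}" "j \<le> c a" by auto
  qed
  have below: "c b < j" if "b \<in> {1..<a}" for b
  proof (rule ccontr)
    assume "\<not> c b < j"
    then have "a \<le> b" unfolding a_def using that a by (intro Min_le) auto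
    then show False using that by simp
  qed
  let ?B = "{b \<in> {a<..n}. c b < j}"
  have "card ({..<j} - c ` {a<..n}) \<le> card ({..<c a} - c ` {a<..n})"
    using a(2) by (rule gaps_mono)
  also have "\<dots> < a" using c a(1) by (auto simp: placements_def)
  finally have gaps: "card ({..<j} - c ` {a<..n}) < a" .
  have "{..<j} \<subseteq> ({..<j} - c ` {a<..n}) \<union> c ` ?B" by auto
  then have "card {..<j} \<le> card (({..<j} - c ` {a<..n}) \<union> c ` ?B)" by (intro card_mono) auto
  then have "j \<le> card (({..<j} - c ` {a<..n}) \<union> c ` ?B)" by simp
  also have "\<dots> \<le> card ({..<j} - c ` {a<..n}) + card (c ` ?B)" by (rule card_Un_le)
  also have "\<dots> \<le> card {1..<a} + card ?B"
    using gaps by (intro add_mono card_image_le) auto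
  also have "\<dots> = card ({1..<a} \<union> ?B)" by (rule card_Un_disjoint[symmetric]) auto
  also have "\<dots> \<le> card {a \<in> {1..n}. c a < j}"
    using below a(1) by (intro card_mono) auto
  finally show ?thesis .
qed

lemma placements_less:
  assumes "c \<in> placements n {}" "a \<in> {1..n}"
  shows "c a < n"
proof -
  have "{a \<in> {1..n}. c a < n} = {1..n}"
    using placements_parking[OF assms(1), of n] by (intro card_seteq) auto
  then show ?thesis using assms(2) by blast
qed

section \<open>Lattice paths with prescribed column sizes\<close>

text \<open>Each column is closed by its right-step. A nonempty Dyck path ends with a right-step, so it has this
  form.\<close>

fun path_of :: "(nat \<Rightarrow> nat) \<Rightarrow> nat \<Rightarrow> step list" where
  "path_of k 0 = []"
| "path_of k (Suc m) = path_of k m @ replicate (k m) Up @ [Right]"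

lemma count_list_replicate: "count_list (replicate r x) y = (if x = y then r else 0)"
  by (induction r) auto

lemma count_path_of [simp]:
  "count_list (path_of k m) Right = m"
  "count_list (path_of k m) Up = (\<Sum>i<m. k i)"
  by (induction m) (auto simp: count_list_replicate)

lemma path_of_cong: "(\<And>x. x < m \<Longrightarrow> k x = k' x) \<Longrightarrow> path_of k m = path_of k' m"
  by (induction m) auto

lemma path_decomposition:
  "\<exists>k r. p = path_of k (count_list p Right) @ replicate r Up"
proof (induction p rule: rev_induct)
  case Nil
  show ?case by (rule exI[of _ undefined], rule exI[of _ 0]) simp
next
  case (snoc s p)
  then obtain k r where p: "p = path_of k (count_list p Right) @ replicate r Up" by blast
  define m where "m = count_list p Right"
  show ?case
  proof (cases s)
    case Up
    have "p @ [s] = path_of k m @ replicate (Suc r) Up"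
      using Up p unfolding m_def[symmetric] by (metis append_assoc replicate_append_same replicate_Suc)
    then show ?thesis using Up unfolding m_def by (intro exI[of _ k] exI[of _ "Suc r"]) simp
  next
    case Right
    have "path_of (k(m := r)) m = path_of k m" by (rule path_of_cong) auto
    then have "p @ [s] = path_of (k(m := r)) (Suc m)"
      using Right p unfolding m_def[symmetric] by (metis append_assoc fun_upd_same path_of.simps(2))
    moreover have "count_list (p @ [s]) Right = Suc m" using Right by (simp add: m_def)
    ultimately show ?thesis by (metis append_Nil2 replicate_0)
  qed
qed

lemma dyck_path_is_path_of:
  assumes "dyck_path n p"
  obtains k where "p = path_of k n"
proof -
  have n: "count_list p Up = n" "count_list p Right = n"
    and dyck: "\<forall>i\<le>length p. count_list (take i p) Right \<le> count_list (take i p) Up"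
    using assms by (auto simp: dyck_path_def)
  obtain k r where p: "p = path_of k n @ replicate r Up"
    using path_decomposition[of p] n by auto
  have "n \<le> (\<Sum>i<n. k i)"
    using dyck[rule_format, of "length (path_of k n)"] by (simp add: p)
  moreover have "(\<Sum>i<n. k i) + r = n" using n(1) by (simp add: p count_list_replicate)
  ultimately have "r = 0" by linarith
  then show ?thesis using p that by simp
qed

lemma up_squares_snoc:
  "up_squares (p @ [s]) =
     up_squares p \<union> (if s = Up then {(count_list p Right, count_list p Up)} else {})"
proof -
  have "{k. k < length (p @ [s]) \<and> (p @ [s]) ! k = Up} =
      {k. k < length p \<and> p ! k = Up} \<union> (if s = Up then {length p} else {})"
    by (auto simp: nth_append less_Suc_eq split: if_splits)
  moreover have "up_squares q = (\<lambda>k. (count_list (take k q) Right, count_list (take k q) Up)) `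
      {k. k < length q \<and> q ! k = Up}" for q
    by (auto simp: up_squares_def)
  ultimately show ?thesis by (simp add: image_Un)
qed

lemma up_squares_append_replicate:
  "up_squares (p @ replicate r Up) =
     up_squares p \<union> {count_list p Right} \<times> {count_list p Up..<count_list p Up + r}"
proof (induction r)
  case (Suc r)
  have "up_squares (p @ replicate (Suc r) Up) = up_squares ((p @ replicate r Up) @ [Up])"
    by (simp add: replicate_append_same)
  also have "\<dots> = up_squares p \<union> {count_list p Right} \<times> {count_list p Up..<count_list p Up + Suc r}"
    unfolding up_squares_snoc Suc by (auto simp: count_list_replicate)
  finally show ?case .
qed simp

lemma up_squares_path_of:
  "up_squares (path_of k m) = (SIGMA x:{..<m}. {(\<Sum>i<x. k i)..<(\<Sum>i<Suc x. k i)})"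
proof (induction m)
  case 0
  show ?case by (simp add: up_squares_def)
next
  case (Suc m)
  have "up_squares (path_of k (Suc m)) = up_squares (path_of k m @ replicate (k m) Up)"
    using up_squares_snoc[of "path_of k m @ replicate (k m) Up" Right] by simp
  moreover have "Sigma {..<Suc m} B = Sigma {..<m} B \<union> {m} \<times> B m" for B :: "nat \<Rightarrow> nat set"
    by (auto simp: less_Suc_eq)
  ultimately show ?case
    by (simp only: up_squares_append_replicate Suc count_path_of sum.lessThan_Suc)
qed

definition weakly_above :: "step list \<Rightarrow> bool" where
  "weakly_above p \<longleftrightarrow> (\<forall>i\<le>length p. count_list (take i p) Right \<le> count_list (take i p) Up)"

lemma weakly_above_snoc:
  "weakly_above (p @ [s]) \<longleftrightarrow>
     weakly_above p \<and> count_list (p @ [s]) Right \<le> count_list (p @ [s]) Up"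
  by (auto simp: weakly_above_def le_Suc_eq)

lemma weakly_above_append_replicate:
  "weakly_above p \<Longrightarrow> weakly_above (p @ replicate r Up)"
proof (induction r)
  case (Suc r)
  have "count_list p Right \<le> count_list p Up"
    using Suc.prems unfolding weakly_above_def by (metis order_refl take_all)
  then have "weakly_above ((p @ replicate r Up) @ [Up])"
    using Suc unfolding weakly_above_snoc by (simp add: count_list_replicate)
  then show ?case by (simp add: replicate_append_same)
qed simp

lemma weakly_above_path_of:
  "(\<And>j. j \<le> m \<Longrightarrow> j \<le> (\<Sum>i<j. k i)) \<Longrightarrow> weakly_above (path_of k m)"
proof (induction m)
  case 0
  show ?case by (simp add: weakly_above_def)
next
  case (Suc m)
  then have "weakly_above (path_of k m @ replicate (k m) Up)"
    by (intro weakly_above_append_replicate Suc.IH) simp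
  then have "weakly_above ((path_of k m @ replicate (k m) Up) @ [Right])"
    unfolding weakly_above_snoc using Suc.prems[of "Suc m"] by (simp add: count_list_replicate)
  then show ?case by simp
qed

section \<open>Labeled paths and column functions\<close>

definition fiber :: "nat \<Rightarrow> (nat \<Rightarrow> nat) \<Rightarrow> nat \<Rightarrow> nat set" where
  "fiber n c x = {a \<in> {1..n}. c a = x}"

lemma finite_fiber [simp]: "finite (fiber n c x)"
  by (simp add: fiber_def)

lemma sum_card_fiber: "(\<Sum>i<x. card (fiber n c i)) = card {a \<in> {1..n}. c a < x}"
proof -
  have "{a \<in> {1..n}. c a < x} = (\<Union>i<x. fiber n c i)" by (auto simp: fiber_def)
  then show ?thesis by (simp only:) (subst card_UN_disjoint, auto simp: fiber_def)
qed

text \<open>The lowest square of column \<open>x\<close> has the height \<open>\<Sum>i<x. card (fiber n c i)\<close>, the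
  number of labels further left; from there on the labels of the column are listed in
  increasing order.\<close>

definition labeled_path_of :: "nat \<Rightarrow> (nat \<Rightarrow> nat) \<Rightarrow> labeled_path" where
  "labeled_path_of n c =
     (let p = path_of (\<lambda>x. card (fiber n c x)) n
      in (p, \<lambda>(x, y)\<in>up_squares p.
               sorted_list_of_set (fiber n c x) ! (y - (\<Sum>i<x. card (fiber n c i)))))"

definition column_function :: "nat \<Rightarrow> labeled_path \<Rightarrow> nat \<Rightarrow> nat" where
  "column_function n P = restrict (column_of P) {1..n}"

lemma nth_sorted_list_of_image:
  fixes g :: "nat \<Rightarrow> nat"
  assumes "\<And>i j. s \<le> i \<Longrightarrow> i < j \<Longrightarrow> j < t \<Longrightarrow> g i < g j" "s \<le> y" "y < t"
  shows "sorted_list_of_set (g ` {s..<t}) ! (y - s) = g y"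
proof -
  have "sorted_wrt (<) (map g [s..<t])"
    unfolding sorted_wrt_map sorted_wrt_iff_nth_less using assms(1) by auto
  then have "sorted_list_of_set (set (map g [s..<t])) = map g [s..<t]"
    by (metis sorted_list_of_set.idem_if_sorted_distinct strict_sorted_iff)
  then show ?thesis using assms(2,3) by simp
qed

lemma parking_columns:
  assumes "parking_function n P"
  shows "column P x = fiber n (column_of P) x"
proof -
  obtain p l where P: "P = (p, l)" by fastforce
  have bij: "bij_betw l (up_squares p) {1..n}"
    using assms by (simp add: P parking_function_def)
  have uniq: "column_of P a = x" if "a \<in> column P x" for a x
    unfolding column_of_def
  proof (rule the_equality[where P = "\<lambda>x. a \<in> column P x"])
    show "a \<in> column P x" by fact
    show "x' = x" if "a \<in> column P x'" for x'
      using \<open>a \<in> column P x\<close> that bij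
      by (auto simp: P column_def bij_betw_def dest: inj_onD)
  qed
  show ?thesis
  proof (intro equalityI subsetI)
    fix a assume a: "a \<in> column P x"
    then have "a \<in> {1..n}" using bij by (auto simp: P column_def bij_betw_def)
    then show "a \<in> fiber n (column_of P) x" using uniq[OF a] by (simp add: fiber_def)
  next
    fix a assume a: "a \<in> fiber n (column_of P) x"
    then obtain x' y where "(x', y) \<in> up_squares p" "l (x', y) = a"
    proof -
      have "a \<in> l ` up_squares p" using a bij by (simp add: fiber_def bij_betw_def)
      then show ?thesis using that by (metis imageE prod.collapse)
    qed
    then have "a \<in> column P x'" by (auto simp: P column_def)
    then show "a \<in> column P x" using a uniq by (auto simp: fiber_def)
  qed
qed

text \<open>The columns not dominated by labels above \<open>a\<close> are those outside the image of \<open>{a<..n}\<close>. Hence the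
  restriction is the placement rule with no columns occupied at the start.\<close>

lemma column_restricted_iff:
  assumes "parking_function n P"
  shows "column_restricted P \<longleftrightarrow> column_function n P \<in> placements n {}"
proof -
  have "labels P = {1..n}"
    using assms by (auto simp: parking_function_def labels_def bij_betw_def split: prod.splits)
  moreover have "dominance_index P a =
      card ({..<column_function n P a} - column_function n P ` {a<..n})" if "a \<in> {1..n}" for a
  proof -
    have "{x. x < column_of P a \<and> \<not> (\<exists>b\<in>column P x. b > a)} =
        {..<column_function n P a} - column_function n P ` {a<..n}"
      using that unfolding parking_columns[OF assms] column_function_def
      by (auto simp: fiber_def)
    then show ?thesis by (simp add: dominance_index_def)
  qed
  ultimately show ?thesis
    by (auto simp: column_restricted_def placements_def column_function_def)
qed

lemma fiber_cong: "(\<And>a. a \<in> {1..n} \<Longrightarrow> c a = c' a) \<Longrightarrow> fiber n c x = fiber n c' x"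
  by (auto simp: fiber_def)

text \<open>A strictly increasing labeling of an interval of squares is the sorted enumeration of its
  image, so the labeling as well as the path is determined by the columns.\<close>

lemma labeled_path_of_column_function:
  assumes P: "parking_function n P"
  shows "labeled_path_of n (column_function n P) = P"
proof -
  obtain p l where [simp]: "P = (p, l)" by fastforce
  have "dyck_path n p" and ext: "l \<in> extensional (up_squares p)"
    and bij: "bij_betw l (up_squares p) {1..n}"
    and incr: "\<And>x y y'. (x, y) \<in> up_squares p \<Longrightarrow> (x, y') \<in> up_squares p \<Longrightarrow> y < y' \<Longrightarrow>
      l (x, y) < l (x, y')"
    using P by (auto simp: parking_function_def)
  then obtain k where p: "p = path_of k n" using dyck_path_is_path_of by blast
  let ?s = "\<lambda>x. \<Sum>i<x. k i"
  have sq: "(x, y) \<in> up_squares p \<longleftrightarrow> x < n \<and> ?s x \<le> y \<and> y < ?s (Suc x)" for x y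
    by (simp add: p up_squares_path_of)
  have fib: "fiber n (column_function n P) x = (\<lambda>y. l (x, y)) ` {?s x..<?s (Suc x)}"
    if "x < n" for x
  proof -
    have "fiber n (column_function n P) x = column P x"
      unfolding parking_columns[OF P] by (rule fiber_cong) (simp add: column_function_def)
    then show ?thesis using that by (auto simp: column_def sq)
  qed
  have card_fib: "card (fiber n (column_function n P) x) = k x" if "x < n" for x
  proof -
    have "inj_on (\<lambda>y. l (x, y)) {?s x..<?s (Suc x)}"
    proof (rule inj_onI)
      fix y y' assume "y \<in> {?s x..<?s (Suc x)}" "y' \<in> {?s x..<?s (Suc x)}" "l (x, y) = l (x, y')"
      then have "(x, y) = (x, y')"
        using bij that by (intro inj_onD[of l "up_squares p"]) (auto simp: bij_betw_def sq)
      then show "y = y'" by simp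
    qed
    then show ?thesis unfolding fib[OF that] by (simp only: card_image) simp
  qed
  have path: "path_of (\<lambda>x. card (fiber n (column_function n P) x)) n = p"
    unfolding p using card_fib by (rule path_of_cong)
  have "sorted_list_of_set (fiber n (column_function n P) x) !
      (y - (\<Sum>i<x. card (fiber n (column_function n P) i))) = l (x, y)"
    if "(x, y) \<in> up_squares p" for x y
  proof -
    have xy: "x < n" "?s x \<le> y" "y < ?s (Suc x)" using that by (auto simp: sq)
    have "(\<Sum>i<x. card (fiber n (column_function n P) i)) = ?s x"
      using xy(1) by (intro sum.cong refl card_fib) simp
    moreover have "sorted_list_of_set ((\<lambda>y. l (x, y)) ` {?s x..<?s (Suc x)}) ! (y - ?s x) = l (x, y)"
      using xy by (intro nth_sorted_list_of_image incr) (auto simp: sq)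
    ultimately show ?thesis by (simp only: fib[OF xy(1)])
  qed
  then have "(\<lambda>(x, y)\<in>up_squares p. sorted_list_of_set (fiber n (column_function n P) x) !
      (y - (\<Sum>i<x. card (fiber n (column_function n P) i)))) = l"
    using ext by (intro extensionalityI[where A = "up_squares p"]) auto
  then show ?thesis unfolding labeled_path_of_def path Let_def by simp
qed

text \<open>The path stays weakly above the diagonal because its height after column \<open>j - 1\<close> is the number
  of labels with a column below \<open>j\<close>, which is at least \<open>j\<close> by \<open>placements_parking\<close>.\<close>

lemma labeled_path_of_placement:
  assumes c: "c \<in> placements n {}"
  shows "parking_function n (labeled_path_of n c)" "column_function n (labeled_path_of n c) = c"
proof -
  define k where "k x = card (fiber n c x)" for x
  define p where "p = path_of k n"
  let ?s = "\<lambda>x. \<Sum>i<x. k i"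
  define l where "l = (\<lambda>(x, y)\<in>up_squares p. sorted_list_of_set (fiber n c x) ! (y - ?s x))"
  have eq: "labeled_path_of n c = (p, l)"
    unfolding labeled_path_of_def Let_def l_def p_def k_def ..
  have s: "?s x = card {a \<in> {1..n}. c a < x}" for x unfolding k_def by (rule sum_card_fiber)
  have sq: "(x, y) \<in> up_squares p \<longleftrightarrow> x < n \<and> ?s x \<le> y \<and> y < ?s x + k x" for x y
    by (simp add: p_def up_squares_path_of)
  have val: "l (x, y) = sorted_list_of_set (fiber n c x) ! (y - ?s x)" if "(x, y) \<in> up_squares p" for x y
    using that by (simp add: l_def)
  have len: "length (sorted_list_of_set (fiber n c x)) = k x" for x by (simp add: k_def)
  have in_fiber: "l (x, y) \<in> fiber n c x" if "(x, y) \<in> up_squares p" for x y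
  proof -
    have "l (x, y) \<in> set (sorted_list_of_set (fiber n c x))"
      unfolding val[OF that] by (rule nth_mem) (use that in \<open>unfold len sq, linarith\<close>)
    then show ?thesis by simp
  qed
  have incr: "l (x, y) < l (x, y')"
    if "(x, y) \<in> up_squares p" "(x, y') \<in> up_squares p" "y < y'" for x y y'
    unfolding val[OF that(1)] val[OF that(2)]
    by (rule sorted_wrt_nth_less[OF strict_sorted_list_of_set])
      (use that in \<open>unfold len sq, linarith+\<close>)
  have sum_n: "?s n = n"
  proof -
    have "{a \<in> {1..n}. c a < n} = {1..n}" using placements_less[OF c] by auto
    then show ?thesis by (simp add: s)
  qed
  have "weakly_above p"
    unfolding p_def using placements_parking[OF c] by (intro weakly_above_path_of) (simp add: s)
  then have dyck: "dyck_path n p"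
    using sum_n by (simp add: dyck_path_def weakly_above_def p_def)
  have inj: "inj_on l (up_squares p)"
  proof (rule inj_onI, clarify)
    fix x y x' y' assume sqs: "(x, y) \<in> up_squares p" "(x', y') \<in> up_squares p"
      and same: "l (x, y) = l (x', y')"
    have "x = x'" using in_fiber[OF sqs(1)] in_fiber[OF sqs(2)] same by (auto simp: fiber_def)
    moreover have "y = y'"
      using incr[of x y y'] incr[of x y' y] sqs same \<open>x = x'\<close> by (cases y y' rule: linorder_cases) auto
    ultimately show "x = x' \<and> y = y'" by simp
  qed
  have surj: "\<exists>y. (c a, y) \<in> up_squares p \<and> l (c a, y) = a" if a: "a \<in> {1..n}" for a
  proof -
    have "a \<in> set (sorted_list_of_set (fiber n c (c a)))" using a by (simp add: fiber_def)
    then obtain i where i: "i < k (c a)" "sorted_list_of_set (fiber n c (c a)) ! i = a"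
      unfolding in_set_conv_nth len by blast
    then have "(c a, ?s (c a) + i) \<in> up_squares p" using placements_less[OF c a] by (simp add: sq)
    then show ?thesis using i(2) val by (intro exI[of _ "?s (c a) + i"]) auto
  qed
  have "l ` up_squares p = {1..n}"
  proof (intro equalityI subsetI)
    fix a assume "a \<in> l ` up_squares p"
    then show "a \<in> {1..n}" using in_fiber by (auto simp: fiber_def)
  next
    fix a assume "a \<in> {1..n}"
    then show "a \<in> l ` up_squares p" using surj by (metis image_eqI)
  qed
  then show park: "parking_function n (labeled_path_of n c)"
    unfolding eq parking_function_def using dyck inj incr by (auto simp: bij_betw_def l_def)
  have "column_of (p, l) a = c a" if a: "a \<in> {1..n}" for a
  proof -
    have "a \<in> column (p, l) (c a)" using surj[OF a] unfolding column_def by force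
    then show ?thesis using parking_columns[OF park] by (simp add: eq fiber_def)
  qed
  moreover have "c \<in> extensional {1..n}" using c by (simp add: placements_def)
  ultimately show "column_function n (labeled_path_of n c) = c"
    unfolding eq column_function_def by (intro extensionalityI[where A = "{1..n}"]) auto
qed

theorem mainTheorem3:
  fixes n :: nat
  assumes "n \<ge> 1"
  shows "card {P. parking_function n P \<and> column_restricted P} = (\<Prod>k=1..n. 2 * k - 1)"
proof -
  have restricted: "column_restricted (labeled_path_of n c)" if "c \<in> placements n {}" for c
    using that column_restricted_iff labeled_path_of_placement by metis
  have "bij_betw (column_function n) {P. parking_function n P \<and> column_restricted P} (placements n {})"
    by (rule bij_betw_byWitness[where f' = "labeled_path_of n"])
      (auto simp: labeled_path_of_column_function labeled_path_of_placement restricted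
        column_restricted_iff[THEN iffD1])
  then have "card {P. parking_function n P \<and> column_restricted P} = card (placements n {})"
    by (rule bij_betw_same_card)
  then show ?thesis using finite_and_card_placements[of "{}" n] by (simp add: ways_empty)
qed

end
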